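(* Let $M=(V,E,B)$ be a reflection complex in $\mathcal{C}$. Then for every edge $K\in E$, the sub-$b$-hypergraph of $M$ on $K$ is thick. In particular $M$ is a thick reflection complex (and its frame is a thick graph).
   Context: A $b$-hypergraph is $M=(V,E,B)$ with $V$ finite, $E\subseteq 2^V$, $B\subseteq 2^V\times2^V$ symmetric; the sub-$b$-hypergraph on $W\subseteq V$ is $(W,\{L\in E:L\subseteq W\},B\cap(2^W\times2^W))$. For $L\in E$, $X\subseteq L$: $r_{L,X}(M)$ has vertex set $V'$ = disjoint union of $V$ and $L$ with the two copies of each $x\in X$ identified (injections $\tau_1:V\to V'$, $\tau_2:L\to V'$); edges $\tau_1(K)$ ($K\in E$), $\tau_2(K)$ ($K\in E,K\subseteq L$), and $\tau_1(K_1)\cup\tau_2(K_2)$ for all $K_1,K_2\in E$ with $K_2\subseteq L$, $X\subseteq K_1\cap K_2$; relation: $\tau_1$-images of pairs in $B$, $\tau_2$-images of pairs in $B\cap(2^L\times2^L)$, and the pairs $(\tau_1(K_1),\tau_2(K_2))$ (and reverses) for such $K_1,K_2$. A reflection complex is obtained from $(\{1,2\},\{\{1,2\}\},\emptyset)$ by finitely many operations $r_{L,X}$. The frame $\mathcal{F}(M)$ is the graph on $V$ whose edges are the $2$-element members of $E$. $\mathcal{C}$ is the set of reflection complexes obtainable from the trivial one by a sequence of operations $N\mapsto r_{L,X}(N)$ in which $X$ spans a forest in $\mathcal{F}(N)$. Thickness: in $\mathbb{R}^{2^V}$, $1_S$ is the indicator of the subset $S$; $t_{A,B}=1_{A\cup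 B}-1_A-1_B+1_{A\cap B}$; $W_B=\mathrm{span}\{t_{A,B}:(A,B)\in B\}$; $Q_V=\mathbb{R}1_\emptyset+$ the cone of nonnegative combinations of all $t_{A,B}$ and $1_A$. For a graph $H$ on $V$ and $X\subseteq V$, $h_H(X)=-1_X+\sum_{e\in E(F)}1_e-\sum_{v\in X}(\deg_F(v)-1)1_{\{v\}}$ with $F$ the subgraph spanned by $X$. A $b$-hypergraph $(V,E,B)$ with frame $H$ is thick if $h_H(V)\in W_B+Q_V$; a thick graph is the frame of a thick reflection complex. *)

theory Defs
  imports "HOL-Analysis.Analysis" "HOL-Library.Function_Algebras"
begin

subsection \<open>Graphs\<close>

type_synonym 'a graph = "'a set \<times> 'a set set"

definition spanned_subgraph :: "'a graph \<Rightarrow> 'a set \<Rightarrow> 'a graph" where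
  "spanned_subgraph H X = (X, {e \<in> snd H. e \<subseteq> X})"

definition degree :: "'a graph \<Rightarrow> 'a \<Rightarrow> nat" where
  "degree F v = card {e \<in> snd F. v \<in> e}"

definition is_cycle :: "'a graph \<Rightarrow> 'a list \<Rightarrow> bool" where
  "is_cycle F vs \<longleftrightarrow> 3 \<le> length vs \<and> distinct vs \<and> set vs \<subseteq> fst F \<and>
     (\<forall>i < length vs. {vs ! i, vs ! (Suc i mod length vs)} \<in> snd F)"

definition forest :: "'a graph \<Rightarrow> bool" where
  "forest F \<longleftrightarrow> (\<nexists>vs. is_cycle F vs)"

subsection \<open>b-hypergraphs\<close>

record 'a bhyp =
  verts :: "'a set"
  hedges :: "'a set set"
  brel :: "('a set \<times> 'a set) set"

definition b_hypergraph :: "'a bhyp \<Rightarrow> bool" where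
  "b_hypergraph M \<longleftrightarrow> finite (verts M) \<and> hedges M \<subseteq> Pow (verts M) \<and>
     brel M \<subseteq> Pow (verts M) \<times> Pow (verts M) \<and> sym (brel M)"

definition sub_bhyp :: "'a bhyp \<Rightarrow> 'a set \<Rightarrow> 'a bhyp" where
  "sub_bhyp M W = \<lparr> verts = W, hedges = {L \<in> hedges M. L \<subseteq> W}, brel = brel M \<inter> (Pow W \<times> Pow W) \<rparr>"

definition frame :: "'a bhyp \<Rightarrow> 'a graph" where
  "frame M = (verts M, {e \<in> hedges M. card e = 2})"

subsection \<open>Reflection complexes\<close>

text \<open>The maps \<open>\<tau>1\<close> and \<open>\<tau>2\<close> exhibit \<open>\<tau>1 ` V \<union> \<tau>2 ` L\<close> as the disjoint union of \<open>V\<close> and \<open>L\<close>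
  with the two copies of each \<open>x \<in> X\<close> identified.\<close>

definition gluing_maps ::
    "'a set \<Rightarrow> 'a set \<Rightarrow> 'a set \<Rightarrow> ('a \<Rightarrow> 'b) \<Rightarrow> ('a \<Rightarrow> 'b) \<Rightarrow> bool" where
  "gluing_maps V L X \<tau>1 \<tau>2 \<longleftrightarrow> inj_on \<tau>1 V \<and> inj_on \<tau>2 L \<and>
     (\<forall>x \<in> V. \<forall>y \<in> L. \<tau>1 x = \<tau>2 y \<longleftrightarrow> x = y \<and> x \<in> X)"

definition reflect ::
    "('a \<Rightarrow> 'b) \<Rightarrow> ('a \<Rightarrow> 'b) \<Rightarrow> 'a set \<Rightarrow> 'a set \<Rightarrow> 'a bhyp \<Rightarrow> 'b bhyp" where
  "reflect \<tau>1 \<tau>2 L X M =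
     (let E = hedges M; B = brel M in
      \<lparr> verts = \<tau>1 ` verts M \<union> \<tau>2 ` L,
        hedges = {\<tau>1 ` K | K. K \<in> E}
          \<union> {\<tau>2 ` K | K. K \<in> E \<and> K \<subseteq> L}
          \<union> {\<tau>1 ` K1 \<union> \<tau>2 ` K2 | K1 K2. K1 \<in> E \<and> K2 \<in> E \<and> K2 \<subseteq> L \<and> X \<subseteq> K1 \<inter> K2},
        brel = {(\<tau>1 ` A, \<tau>1 ` C) | A C. (A, C) \<in> B}
          \<union> {(\<tau>2 ` A, \<tau>2 ` C) | A C. (A, C) \<in> B \<inter> (Pow L \<times> Pow L)}
          \<union> {(\<tau>1 ` K1, \<tau>2 ` K2) | K1 K2. K1 \<in> E \<and> K2 \<in> E \<and> K2 \<subseteq> L \<and> X \<subseteq> K1 \<inter> K2}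
          \<union> {(\<tau>2 ` K2, \<tau>1 ` K1) | K1 K2. K1 \<in> E \<and> K2 \<in> E \<and> K2 \<subseteq> L \<and> X \<subseteq> K1 \<inter> K2} \<rparr>)"

text \<open>Complexes are taken up to isomorphism: the two initial vertices and the gluing maps are
  arbitrary. Keeping one vertex type \<open>'a\<close> loses nothing, because the vertex sets occurring in
  a construction never shrink and so have copies in the final vertex set.\<close>

inductive reflection_complex :: "'a bhyp \<Rightarrow> bool" where
  trivial: "a \<noteq> b \<Longrightarrow>
    reflection_complex \<lparr> verts = {a, b}, hedges = {{a, b}}, brel = {} \<rparr>"
| reflect: "\<lbrakk> reflection_complex N; L \<in> hedges N; X \<subseteq> L; gluing_maps (verts N) L X \<tau>1 \<tau>2 \<rbrakk>
    \<Longrightarrow> reflection_complex (reflect \<tau>1 \<tau>2 L X N)"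

inductive_set class_C :: "'a bhyp set" where
  trivial: "a \<noteq> b \<Longrightarrow> \<lparr> verts = {a, b}, hedges = {{a, b}}, brel = {} \<rparr> \<in> class_C"
| reflect: "\<lbrakk> N \<in> class_C; L \<in> hedges N; X \<subseteq> L; gluing_maps (verts N) L X \<tau>1 \<tau>2;
      forest (spanned_subgraph (frame N) X) \<rbrakk>
    \<Longrightarrow> reflect \<tau>1 \<tau>2 L X N \<in> class_C"

lemma class_C_reflection_complex: "M \<in> class_C \<Longrightarrow> reflection_complex M"
  by (induction rule: class_C.induct) (blast intro: reflection_complex.intros)+

subsection \<open>Thickness\<close>

instantiation "fun" :: (type, scaleR) scaleR
begin

definition scaleR_fun :: "real \<Rightarrow> ('a \<Rightarrow> 'b) \<Rightarrow> 'a \<Rightarrow> 'b" where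
  "scaleR_fun c f = (\<lambda>x. c *\<^sub>R f x)"

instance ..

end

instance "fun" :: (type, real_vector) real_vector
  by standard (simp_all add: scaleR_fun_def fun_eq_iff scaleR_add_right scaleR_add_left)

text \<open>Vectors of \<open>\<real>\<close> to the power \<open>2\<^sup>V\<close> are functions \<open>'a set \<Rightarrow> real\<close>; all those below vanish
  outside \<open>Pow V\<close> when their arguments are subsets of \<open>V\<close>.\<close>

abbreviation ind :: "'a set \<Rightarrow> 'a set \<Rightarrow> real" where
  "ind S \<equiv> indicator {S}"

definition t_vec :: "'a set \<Rightarrow> 'a set \<Rightarrow> 'a set \<Rightarrow> real" where
  "t_vec A C = ind (A \<union> C) - ind A - ind C + ind (A \<inter> C)"

definition W_space :: "('a set \<times> 'a set) set \<Rightarrow> ('a set \<Rightarrow> real) set" where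
  "W_space B = span {t_vec A C | A C. (A, C) \<in> B}"

definition Q_cone :: "'a set \<Rightarrow> ('a set \<Rightarrow> real) set" where
  "Q_cone V = {c *\<^sub>R ind {} + q | c q.
     q \<in> convex_cone hull ({t_vec A C | A C. A \<subseteq> V \<and> C \<subseteq> V} \<union> {ind A | A. A \<subseteq> V})}"

definition h_vec :: "'a graph \<Rightarrow> 'a set \<Rightarrow> 'a set \<Rightarrow> real" where
  "h_vec H X = (let F = spanned_subgraph H X in
     - ind X + (\<Sum>e \<in> snd F. ind e) - (\<Sum>v \<in> X. (real (degree F v) - 1) *\<^sub>R ind {v}))"

definition thick :: "'a bhyp \<Rightarrow> bool" where
  "thick M \<longleftrightarrow> b_hypergraph M \<and>
     h_vec (frame M) (verts M) \<in> {w + q | w q. w \<in> W_space (brel M) \<and> q \<in> Q_cone (verts M)}"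

definition thick_graph :: "'a graph \<Rightarrow> bool" where
  "thick_graph H \<longleftrightarrow> (\<exists>N. reflection_complex N \<and> thick N \<and> frame N = H)"

end

(* Write h(K) for the vector h of the frame restricted to K. If K = K1 \<union> K2 is a mixed edge of a
   reflection, glued along X, then inclusion-exclusion gives
     h(K) = - t(K1, K2) + h(K1) + h(K2) - h(X),
   where t(K1, K2) lies in W because (K1, K2) is a new pair of the relation, and h(K1), h(K2) are
   handled by induction. If X spans a forest, then -h(X) lies in Q: removing a leaf v with edge e from
   X leaves A = X - {v}, and the same identity with h(e) = 0 and A \<inter> e a single vertex gives
   -h(X) = t(A, e) - h(A); removing an isolated vertex only adds a multiple of the indicator of the
   empty set. *)

theory Submission
  imports Defs
begin

section \<open>The cone of vectors that witness thickness\<close>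

text \<open>Relation and vertex set are separate arguments because both grow when a smaller edge is
  viewed inside a larger one.\<close>

definition thick_cone :: "('a set \<times> 'a set) set \<Rightarrow> 'a set \<Rightarrow> ('a set \<Rightarrow> real) set" where
  "thick_cone B V = {w + q | w q. w \<in> W_space B \<and> q \<in> Q_cone V}"

lemma W_space_mono: "B \<subseteq> B' \<Longrightarrow> W_space B \<subseteq> W_space B'"
  unfolding W_space_def by (rule span_mono) auto

lemma Q_cone_mono:
  assumes "V \<subseteq> V'"
  shows "Q_cone V \<subseteq> Q_cone V'"
proof -
  have "convex_cone hull ({t_vec A C | A C. A \<subseteq> V \<and> C \<subseteq> V} \<union> {ind A | A. A \<subseteq> V})
    \<subseteq> convex_cone hull ({t_vec A C | A C. A \<subseteq> V' \<and> C \<subseteq> V'} \<union> {ind A | A. A \<subseteq> V'})"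
    by (rule hull_mono) (use assms in blast)
  then show ?thesis
    unfolding Q_cone_def by blast
qed

lemma thick_cone_mono: "B \<subseteq> B' \<Longrightarrow> V \<subseteq> V' \<Longrightarrow> thick_cone B V \<subseteq> thick_cone B' V'"
  unfolding thick_cone_def using W_space_mono Q_cone_mono by blast

lemma Q_cone_add:
  assumes "p \<in> Q_cone V" "q \<in> Q_cone V"
  shows "p + q \<in> Q_cone V"
proof -
  let ?H = "convex_cone hull ({t_vec A C | A C. A \<subseteq> V \<and> C \<subseteq> V} \<union> {ind A | A. A \<subseteq> V})"
  obtain c p' d q' where "p = c *\<^sub>R ind {} + p'" "q = d *\<^sub>R ind {} + q'" "p' \<in> ?H" "q' \<in> ?H"
    using assms unfolding Q_cone_def by blast
  moreover from this have "p + q = (c + d) *\<^sub>R ind {} + (p' + q')"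
    by (simp add: algebra_simps)
  moreover have "p' + q' \<in> ?H"
    using calculation by (intro convex_cone_hull_add)
  ultimately show ?thesis
    unfolding Q_cone_def by blast
qed

text \<open>The coefficient \<open>c\<close> has no sign condition: forests need the values 1 and
  -1, and 0 gives the zero vector.\<close>

lemma ind_empty_in_Q_cone: "c *\<^sub>R ind {} \<in> Q_cone V"
proof -
  have "c *\<^sub>R ind {} = c *\<^sub>R ind {} + 0"
    by simp
  then show ?thesis
    unfolding Q_cone_def using convex_cone_hull_contains_0 by blast
qed

lemma t_vec_in_Q_cone:
  assumes "A \<subseteq> V" "C \<subseteq> V"
  shows "t_vec A C \<in> Q_cone V"
proof -
  have "t_vec A C = 0 *\<^sub>R ind {} + t_vec A C"
    by simp
  moreover have "t_vec A C
      \<in> convex_cone hull ({t_vec A C | A C. A \<subseteq> V \<and> C \<subseteq> V} \<union> {ind A | A. A \<subseteq> V})"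
    using assms by (intro hull_inc) blast
  ultimately show ?thesis
    unfolding Q_cone_def by blast
qed

lemma thick_cone_add:
  assumes "f \<in> thick_cone B V" "g \<in> thick_cone B V"
  shows "f + g \<in> thick_cone B V"
proof -
  obtain w q w' q' where "f = w + q" "g = w' + q'" "w \<in> W_space B" "w' \<in> W_space B"
    "q \<in> Q_cone V" "q' \<in> Q_cone V"
    using assms unfolding thick_cone_def by blast
  then have "f + g = (w + w') + (q + q')" "w + w' \<in> W_space B" "q + q' \<in> Q_cone V"
    by (auto simp: W_space_def span_add Q_cone_add)
  then show ?thesis
    unfolding thick_cone_def by blast
qed

lemma Q_cone_subset_thick_cone: "Q_cone V \<subseteq> thick_cone B V"
proof
  fix q assume "q \<in> Q_cone V"
  moreover have "q = 0 + q" by simp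
  moreover have "0 \<in> W_space B"
    by (simp add: W_space_def span_zero)
  ultimately show "q \<in> thick_cone B V"
    unfolding thick_cone_def by blast
qed

lemma W_space_subset_thick_cone: "W_space B \<subseteq> thick_cone B V"
proof
  fix w assume "w \<in> W_space B"
  moreover have "w = w + 0 *\<^sub>R ind {}" by simp
  ultimately show "w \<in> thick_cone B V"
    unfolding thick_cone_def using ind_empty_in_Q_cone by blast
qed

section \<open>Transport along injections\<close>

text \<open>Taking preimages makes this linear in \<open>f\<close> for every \<tau>. For injective
  \<tau> it is the relabelling of subsets of \<open>V\<close>, extended by zero to all other
  sets.\<close>

definition push :: "('a \<Rightarrow> 'b) \<Rightarrow> 'a set \<Rightarrow> ('a set \<Rightarrow> real) \<Rightarrow> 'b set \<Rightarrow> real" where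
  "push \<tau> V f = (\<lambda>S. if S \<subseteq> \<tau> ` V then f (V \<inter> \<tau> -` S) else 0)"

lemma linear_push: "linear (push \<tau> V)"
  by (rule linearI) (auto simp: push_def scaleR_fun_def fun_eq_iff)

lemma push_ind:
  assumes "inj_on \<tau> V" "A \<subseteq> V"
  shows "push \<tau> V (ind A) = ind (\<tau> ` A)"
proof
  fix S
  have "V \<inter> \<tau> -` S = A \<longleftrightarrow> S = \<tau> ` A" if "S \<subseteq> \<tau> ` V"
    using that assms by (auto simp: inj_on_def)
  then show "push \<tau> V (ind A) S = ind (\<tau> ` A) S"
    using assms by (auto simp: push_def indicator_def)
qed

lemma push_t_vec:
  assumes "inj_on \<tau> V" "A \<subseteq> V" "C \<subseteq> V"
  shows "push \<tau> V (t_vec A C) = t_vec (\<tau> ` A) (\<tau> ` C)"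
proof -
  have "\<tau> ` (A \<inter> C) = \<tau> ` A \<inter> \<tau> ` C"
    using assms by (intro inj_on_image_Int)
  moreover have "A \<inter> C \<subseteq> V" "A \<union> C \<subseteq> V"
    using assms by auto
  ultimately show ?thesis
    using assms unfolding t_vec_def
    by (simp add: linear_add[OF linear_push] linear_diff[OF linear_push] push_ind image_Un)
qed

text \<open>A linear map commutes with spans and convex cone hulls, so only generators need
  checking, and these are relabelled by \<open>push_ind\<close> and \<open>push_t_vec\<close>. The
  free multiple of \<open>ind {}\<close> is fixed because the image of the empty set is
  empty.\<close>

lemma push_thick_cone:
  assumes inj: "inj_on \<tau> V" and B: "B \<subseteq> Pow V \<times> Pow V" and f: "f \<in> thick_cone B V"
  shows "push \<tau> V f \<in> thick_cone ((\<lambda>(A, C). (\<tau> ` A, \<tau> ` C)) ` B) (\<tau> ` V)"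
proof -
  let ?p = "push \<tau> V" and ?B = "(\<lambda>(A, C). (\<tau> ` A, \<tau> ` C)) ` B"
  let ?G = "\<lambda>V. {t_vec A C | A C. A \<subseteq> V \<and> C \<subseteq> V} \<union> {ind A | A. A \<subseteq> V}"
  obtain w c q where f_eq: "f = w + (c *\<^sub>R ind {} + q)"
    and w: "w \<in> span {t_vec A C | A C. (A, C) \<in> B}" and q: "q \<in> convex_cone hull (?G V)"
    using f unfolding thick_cone_def W_space_def Q_cone_def by blast
  have "?p w \<in> span (?p ` {t_vec A C | A C. (A, C) \<in> B})"
    using w linear_span_image[OF linear_push] by blast
  also have "\<dots> \<subseteq> W_space ?B"
    unfolding W_space_def
  proof (rule span_mono, rule image_subsetI)
    fix g assume "g \<in> {t_vec A C | A C. (A, C) \<in> B}"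
    then obtain A C where "g = t_vec A C" "(A, C) \<in> B"
      by blast
    moreover from this have "?p g = t_vec (\<tau> ` A) (\<tau> ` C)"
      using B push_t_vec[OF inj, of A C] by auto
    ultimately show "?p g \<in> {t_vec A C | A C. (A, C) \<in> ?B}"
      by force
  qed
  finally have 1: "?p w \<in> W_space ?B" .
  have "?p q \<in> convex_cone hull (?p ` ?G V)"
    using q convex_cone_hull_linear_image[OF linear_push] by blast
  also have "\<dots> \<subseteq> convex_cone hull (?G (\<tau> ` V))"
  proof (rule hull_mono, rule image_subsetI)
    fix g assume "g \<in> ?G V"
    then consider A C where "g = t_vec A C" "A \<subseteq> V" "C \<subseteq> V" | A where "g = ind A" "A \<subseteq> V"
      by blast
    then show "?p g \<in> ?G (\<tau> ` V)"
    proof cases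
      case 1
      then have "?p g = t_vec (\<tau> ` A) (\<tau> ` C)" "\<tau> ` A \<subseteq> \<tau> ` V" "\<tau> ` C \<subseteq> \<tau> ` V"
        using push_t_vec[OF inj] by auto
      then show ?thesis by blast
    next
      case 2
      then have "?p g = ind (\<tau> ` A)" "\<tau> ` A \<subseteq> \<tau> ` V"
        using push_ind[OF inj] by auto
      then show ?thesis by blast
    qed
  qed
  finally have "c *\<^sub>R ind {} + ?p q \<in> Q_cone (\<tau> ` V)"
    unfolding Q_cone_def by blast
  moreover have "?p f = ?p w + (c *\<^sub>R ind {} + ?p q)"
    unfolding f_eq using push_ind[OF inj, of "{}"]
    by (simp add: linear_add[OF linear_push] linear_scale[OF linear_push])
  ultimately show ?thesis
    using 1 unfolding thick_cone_def by blast
qed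

section \<open>The vector h and inclusion-exclusion\<close>

text \<open>This is \<open>h_vec\<close> with the edge set of the spanned subgraph as an argument of
  its own, so that unions, intersections and images of edge sets can be formed without naming an
  ambient graph.\<close>

definition h_edges :: "'a set set \<Rightarrow> 'a set \<Rightarrow> 'a set \<Rightarrow> real" where
  "h_edges F X = - ind X + (\<Sum>e \<in> F. ind e)
     - (\<Sum>v \<in> X. (real (card {e \<in> F. v \<in> e}) - 1) *\<^sub>R ind {v})"

text \<open>An injection preserves incidence and is injective on edges, hence preserves all degrees;
  linearity of \<open>push\<close> then treats the three kinds of terms separately.\<close>

lemma push_h_edges:
  assumes inj: "inj_on \<tau> V" and X: "X \<subseteq> V" and F: "F \<subseteq> Pow X"
  shows "push \<tau> V (h_edges F X) = h_edges ((`) \<tau> ` F) (\<tau> ` X)"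
proof -
  have injX: "inj_on \<tau> X"
    using inj X by (rule inj_on_subset)
  then have injF: "inj_on ((`) \<tau>) F"
    using F inj_on_image_Pow inj_on_subset by blast
  have deg: "card {e \<in> (`) \<tau> ` F. \<tau> v \<in> e} = card {e \<in> F. v \<in> e}" if v: "v \<in> X" for v
  proof -
    have "{e \<in> (`) \<tau> ` F. \<tau> v \<in> e} = (`) \<tau> ` {e \<in> F. v \<in> e}"
    proof -
      have "\<tau> v \<in> \<tau> ` e \<longleftrightarrow> v \<in> e" if "e \<in> F" for e
        using that v F injX by (intro inj_on_image_mem_iff[of _ X]) auto
      then show ?thesis by blast
    qed
    then show ?thesis
      using injF by (simp add: card_image inj_on_def)
  qed
  have edge: "push \<tau> V (ind e) = ind (\<tau> ` e)" if "e \<in> F" for e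
    using that F X by (intro push_ind[OF inj]) auto
  have vert: "push \<tau> V (ind {v}) = ind {\<tau> v}" if "v \<in> X" for v
    using that X push_ind[OF inj, of "{v}"] by auto
  note lin = linear_push[of \<tau> V]
  show ?thesis
    unfolding h_edges_def linear_diff[OF lin] linear_add[OF lin] linear_neg[OF lin]
      linear_sum[OF lin] linear_scale[OF lin]
    using injX injF
    by (simp add: sum.reindex deg edge vert push_ind[OF inj X] o_def)
qed

text \<open>Serves to carry thickness of an edge to its copies in a reflection. The target relation
  may contain more than the image pairs, since the cone is monotone in the relation.\<close>

lemma image_h_edges_thick:
  assumes inj: "inj_on \<tau> A" and F: "F \<subseteq> Pow A"
    and thick: "h_edges F A \<in> thick_cone (B \<inter> Pow A \<times> Pow A) A"
    and B': "\<And>P Q. (P, Q) \<in> B \<Longrightarrow> P \<subseteq> A \<Longrightarrow> Q \<subseteq> A \<Longrightarrow> (\<tau> ` P, \<tau> ` Q) \<in> B'"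
  shows "h_edges ((`) \<tau> ` F) (\<tau> ` A) \<in> thick_cone (B' \<inter> Pow (\<tau> ` A) \<times> Pow (\<tau> ` A)) (\<tau> ` A)"
proof -
  let ?B = "(\<lambda>(P, Q). (\<tau> ` P, \<tau> ` Q)) ` (B \<inter> Pow A \<times> Pow A)"
  have "h_edges ((`) \<tau> ` F) (\<tau> ` A) = push \<tau> A (h_edges F A)"
    using inj F by (intro push_h_edges[symmetric]) auto
  also have "\<dots> \<in> thick_cone ?B (\<tau> ` A)"
    using inj thick by (intro push_thick_cone) auto
  also have "thick_cone ?B (\<tau> ` A) \<subseteq> thick_cone (B' \<inter> Pow (\<tau> ` A) \<times> Pow (\<tau> ` A)) (\<tau> ` A)"
    using B' by (intro thick_cone_mono order_refl) auto
  finally show ?thesis .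
qed

text \<open>The edge sum and the vertex coefficients are modular in the graph. Only the term
  \<open>- ind\<close> is not, and its defect is exactly \<open>- t_vec X Y\<close>.\<close>

lemma h_edges_Un:
  assumes fin: "finite X" "finite Y" and F: "F \<subseteq> Pow X" and G: "G \<subseteq> Pow Y"
  shows "h_edges (F \<union> G) (X \<union> Y)
    = - t_vec X Y + h_edges F X + h_edges G Y - h_edges (F \<inter> G) (X \<inter> Y)"
proof -
  \<comment> \<open>Replacing the constant 1 by the membership of \<open>v\<close> extends each
    coefficient by zero: a vertex outside the set lies on none of its edges. All four vertex sums
    then run over \<open>X \<union> Y\<close>.\<close>
  let ?D = "\<lambda>F X v. real (card {e \<in> F. v \<in> e}) - of_bool (v \<in> X)"
  have eq: "h_edges F' Z = - ind Z + (\<Sum>e \<in> F'. ind e) - (\<Sum>v \<in> X \<union> Y. ?D F' Z v *\<^sub>R ind {v})"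
    if "F' \<subseteq> Pow Z" "Z \<subseteq> X \<union> Y" for F' Z
  proof -
    have "(\<Sum>v \<in> Z. (real (card {e \<in> F'. v \<in> e}) - 1) *\<^sub>R ind {v})
      = (\<Sum>v \<in> X \<union> Y. ?D F' Z v *\<^sub>R ind {v})"
    proof (rule sum.mono_neutral_cong_left)
      show "\<forall>v \<in> X \<union> Y - Z. ?D F' Z v *\<^sub>R ind {v} = 0"
      proof
        fix v assume "v \<in> X \<union> Y - Z"
        then have "{e \<in> F'. v \<in> e} = {}" "v \<notin> Z"
          using that by auto
        then show "?D F' Z v *\<^sub>R ind {v} = 0"
          by (simp only: card.empty) simp
      qed
      show "finite (X \<union> Y)"
        using fin by simp
      show "Z \<subseteq> X \<union> Y"
        by fact
    qed simp
    then show ?thesis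
      by (simp only: h_edges_def)
  qed
  have finF: "finite F" "finite G"
    using F G fin by (simp_all add: finite_subset[of _ "Pow _"])
  have D: "?D (F \<union> G) (X \<union> Y) v = ?D F X v + ?D G Y v - ?D (F \<inter> G) (X \<inter> Y) v" for v
  proof -
    have "card {e \<in> F. v \<in> e} + card {e \<in> G. v \<in> e}
      = card ({e \<in> F. v \<in> e} \<union> {e \<in> G. v \<in> e}) + card ({e \<in> F. v \<in> e} \<inter> {e \<in> G. v \<in> e})"
      using finF by (intro card_Un_Int) auto
    moreover have "{e \<in> F. v \<in> e} \<union> {e \<in> G. v \<in> e} = {e \<in> F \<union> G. v \<in> e}"
      "{e \<in> F. v \<in> e} \<inter> {e \<in> G. v \<in> e} = {e \<in> F \<inter> G. v \<in> e}"
      by auto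
    ultimately show ?thesis
      by auto
  qed
  define S where "S F X' = (\<Sum>v \<in> X \<union> Y. ?D F X' v *\<^sub>R ind {v})" for F :: "'a set set" and X' :: "'a set"
  define E where "E F = (\<Sum>e \<in> F. ind e)" for F :: "'a set set"
  have "S (F \<union> G) (X \<union> Y) = S F X + S G Y - S (F \<inter> G) (X \<inter> Y)"
    unfolding D S_def scaleR_diff_left scaleR_add_left sum.distrib sum_subtractf ..
  moreover have "E (F \<union> G) = E F + E G - E (F \<inter> G)"
    unfolding E_def using sum.union_inter[OF finF, of ind] by (simp add: algebra_simps)
  moreover have "F \<union> G \<subseteq> Pow (X \<union> Y)" "F \<inter> G \<subseteq> Pow (X \<inter> Y)" "X \<inter> Y \<subseteq> X \<union> Y"
    using F G by auto
  moreover have "h_edges F' Z = - ind Z + E F' - S F' Z" if "F' \<subseteq> Pow Z" "Z \<subseteq> X \<union> Y" for F' Z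
    using eq[OF that] by (simp only: S_def E_def)
  ultimately show ?thesis
    unfolding t_vec_def using F G by simp
qed

section \<open>Forests\<close>

text \<open>Take the first vertex of a longest path. Any further neighbour either prolongs the path
  or lies on it and closes a cycle. Isolated vertices count as leaves here.\<close>

lemma forest_has_leaf:
  assumes fin: "finite X" and ne: "X \<noteq> {}" and E: "\<And>e. e \<in> E \<Longrightarrow> e \<subseteq> X \<and> card e = 2"
    and forest: "forest (X, E)"
  obtains v where "v \<in> X" "\<And>e e'. e \<in> E \<Longrightarrow> e' \<in> E \<Longrightarrow> v \<in> e \<Longrightarrow> v \<in> e' \<Longrightarrow> e = e'"
proof (rule ccontr)
  assume no_leaf: "\<not> thesis"
  note leaf = that
  define P where "P p \<longleftrightarrow> p \<noteq> [] \<and> distinct p \<and> set p \<subseteq> X \<and>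
      (\<forall>i. Suc i < length p \<longrightarrow> {p ! i, p ! Suc i} \<in> E)"
    for p
  obtain x where "x \<in> X"
    using ne by blast
  then have "P [x]" by (simp add: P_def)
  moreover have "length p < Suc (card X)" if "P p" for p
    using that fin card_mono[of X "set p"] distinct_card[of p] by (auto simp: P_def)
  ultimately have "\<exists>p. P p \<and> (\<forall>q. P q \<longrightarrow> length q \<le> length p)"
    by (intro ex_has_greatest_nat allI impI)
  then obtain p where p: "P p" and longest: "\<And>q. P q \<Longrightarrow> length q \<le> length p"
    by blast
  define v where "v = p ! 0"
  have v: "v \<in> X" "v \<in> set p"
    using p by (auto simp: P_def v_def)
  obtain e e' where "e \<in> E" "e' \<in> E" "v \<in> e" "v \<in> e'" "e \<noteq> e'"
    using no_leaf leaf v by blast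
  \<comment> \<open>At least one of the two edges at \<open>v\<close> differs from
    \<open>{v, p ! 1}\<close>. If the path has one vertex, \<open>p ! 1\<close> is unspecified, but
    the inequality only serves to exclude \<open>j = 1\<close>.\<close>
  then obtain f where f: "f \<in> E" "v \<in> f" "f \<noteq> {v, p ! 1}"
    by metis
  then obtain u where u: "f = {v, u}" "u \<noteq> v" "u \<in> X"
    using E[OF f(1)] by (auto simp: card_2_iff)
  show False
  proof (cases "u \<in> set p")
    case False
    have "P (u # p)"
      using p False u f(1) by (auto simp: P_def nth_Cons v_def insert_commute split: nat.split)
    then show False
      using longest by fastforce
  next
    case True
    then obtain j where j: "j < length p" "u = p ! j"
      by (auto simp: in_set_conv_nth)
    have "j \<noteq> 0" "j \<noteq> 1"
      using j(2) u f(3) unfolding v_def by metis+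
    then have j2: "2 \<le> j" by simp
    \<comment> \<open>The initial segment up to \<open>u\<close> is closed by the edge
      \<open>f\<close>; it has \<open>Suc j\<close> vertices, at least 3 because \<open>j\<close> is
      neither 0 nor 1.\<close>
    have "is_cycle (X, E) (take (Suc j) p)"
      unfolding is_cycle_def
    proof (intro conjI allI impI)
      show "3 \<le> length (take (Suc j) p)" using j j2 by simp
      show "distinct (take (Suc j) p)" using p by (simp add: P_def)
      show "set (take (Suc j) p) \<subseteq> fst (X, E)"
        using p set_take_subset by (fastforce simp: P_def)
      fix i assume "i < length (take (Suc j) p)"
      then have i: "i \<le> j" using j by simp
      have l: "length (take (Suc j) p) = Suc j" using j by simp
      show "{take (Suc j) p ! i, take (Suc j) p ! (Suc i mod length (take (Suc j) p))} \<in> snd (X, E)"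
      proof (cases "i = j")
        case True
        then show ?thesis
          unfolding l using f u j by (simp add: v_def insert_commute)
      next
        case False
        then show ?thesis
          unfolding l using p i j by (simp add: P_def)
      qed
    qed
    then show False using forest by (auto simp: forest_def)
  qed
qed

text \<open>Induction deleting a vertex on at most one edge; every cycle of the remaining graph is
  one of the original, so it stays a forest. Each deletion contributes a generator
  \<open>t_vec\<close> with the right sign.\<close>

lemma uminus_h_edges_forest:
  assumes "finite X" "\<And>e. e \<in> E \<Longrightarrow> e \<subseteq> X \<and> card e = 2" "forest (X, E)"
  shows "- h_edges E X \<in> Q_cone X"
  using assms
proof (induction X arbitrary: E rule: finite_psubset_induct)
  case (psubset X)
  note E = psubset.prems(1)
  show ?case
  proof (cases "X = {}")
    case True
    then have "E = {}"
      using E by fastforce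
    then have "- h_edges E X = 1 *\<^sub>R ind {}"
      using True by (simp add: h_edges_def)
    then show ?thesis
      using ind_empty_in_Q_cone by metis
  next
    case False
    obtain v where v: "v \<in> X"
      and leaf: "\<And>e e'. e \<in> E \<Longrightarrow> e' \<in> E \<Longrightarrow> v \<in> e \<Longrightarrow> v \<in> e' \<Longrightarrow> e = e'"
      using forest_has_leaf[OF psubset.hyps False E psubset.prems(2)] by metis
    define A F where "A = X - {v}" and "F = {e \<in> E. v \<notin> e}"
    have A: "A \<subset> X" "finite A" "A \<subseteq> X" and F: "\<And>e. e \<in> F \<Longrightarrow> e \<subseteq> A \<and> card e = 2" "F \<subseteq> Pow A"
      using v E psubset.hyps by (auto simp: A_def F_def)
    have "forest (A, F)"
      using psubset.prems(2) by (auto simp: forest_def is_cycle_def A_def F_def)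
    then have "- h_edges F A \<in> Q_cone A"
      using psubset.IH A F by blast
    then have IH: "- h_edges F A \<in> Q_cone X"
      using Q_cone_mono A by blast
    show ?thesis
    proof (cases "\<exists>e \<in> E. v \<in> e")
      case False
      then have "E = F" "X = A \<union> {v}" "A \<inter> {v} = {}"
        using v by (auto simp: F_def A_def)
      \<comment> \<open>An isolated vertex is glued on along the empty set. The one-vertex graph has
        h equal to zero, and the empty graph leaves \<open>ind {}\<close>.\<close>
      then have "h_edges E X = - t_vec A {v} + h_edges F A + h_edges {} {v} - h_edges {} {}"
        using h_edges_Un[of A "{v}" F "{}"] A F by simp
      also have "\<dots> = - t_vec A {v} + h_edges F A + ind {}"
        by (simp add: h_edges_def)
      finally have "- h_edges E X = t_vec A {v} + - h_edges F A + (-1) *\<^sub>R ind {}"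
        by simp
      moreover have "t_vec A {v} \<in> Q_cone X"
        using A v by (intro t_vec_in_Q_cone) auto
      ultimately show ?thesis
        using IH Q_cone_add ind_empty_in_Q_cone by metis
    next
      case True
      then obtain e where e: "e \<in> E" "v \<in> e" by blast
      then obtain u where u: "e = {u, v}" "u \<noteq> v" "u \<in> X"
        using E[OF e(1)] by (auto simp: card_2_iff)
      \<comment> \<open>By the leaf property \<open>e\<close> is the only edge at \<open>v\<close>,
        so \<open>X\<close> arises from \<open>A\<close> and \<open>e\<close> by gluing at the
        single vertex \<open>u\<close>.\<close>
      have "E = F \<union> {e}" "F \<inter> {e} = {}" "X = A \<union> e" "A \<inter> e = {u}"
        using v e u leaf by (auto simp: F_def A_def)
      then have "h_edges E X = - t_vec A e + h_edges F A + h_edges {e} e - h_edges {} {u}"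
        using h_edges_Un[of A e F "{e}"] A F u by simp
      also have "h_edges {} {u} = 0"
        by (simp add: h_edges_def)
      also have "h_edges {e} e = 0"
      proof -
        \<comment> \<open>Both endpoints have degree 1, so the vertex terms vanish and the edge
          cancels against the whole set.\<close>
        have "{e' \<in> {e}. w \<in> e'} = {e}" if "w \<in> e" for w
          using that by auto
        then show ?thesis by (simp add: h_edges_def)
      qed
      finally have "- h_edges E X = t_vec A e + - h_edges F A"
        by (simp add: fun_eq_iff)
      moreover have "t_vec A e \<in> Q_cone X"
        using A e E by (intro t_vec_in_Q_cone) auto
      ultimately show ?thesis
        using IH Q_cone_add by metis
    qed
  qed
qed

section \<open>Frame edges and thickness of restrictions\<close>

definition two_edges :: "'a bhyp \<Rightarrow> 'a set \<Rightarrow> 'a set set" where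
  "two_edges M Y = {e \<in> hedges M. card e = 2 \<and> e \<subseteq> Y}"

text \<open>Used with \<open>P e\<close> saying that the copy of \<open>e\<close> under a gluing map
  lies in a given set of the reflection.\<close>

lemma two_edges_restrict:
  assumes "A \<subseteq> Y" "\<And>e. e \<subseteq> Y \<Longrightarrow> P e \<longleftrightarrow> e \<subseteq> A"
  shows "{e \<in> two_edges H Y. P e} = two_edges H A"
  using assms by (auto simp: two_edges_def)

text \<open>Restricting to \<open>K\<close> and then taking the subgraph spanned by \<open>K\<close>
  filters the edges twice by the same condition. The right-hand side is the form used in the
  induction.\<close>

lemma thick_sub_bhyp_iff:
  assumes M: "b_hypergraph M" and K: "K \<subseteq> verts M"
  shows "thick (sub_bhyp M K) \<longleftrightarrow>
    h_edges (two_edges M K) K \<in> thick_cone (brel M \<inter> Pow K \<times> Pow K) K"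
proof -
  have "b_hypergraph (sub_bhyp M K)"
    using M K finite_subset by (auto simp: b_hypergraph_def sub_bhyp_def sym_def)
  moreover have "{e. (e \<in> hedges M \<and> e \<subseteq> K \<and> card e = 2) \<and> e \<subseteq> K} = two_edges M K"
    by (auto simp: two_edges_def)
  then have "h_vec (frame (sub_bhyp M K)) K = h_edges (two_edges M K) K"
    by (simp add: h_vec_def frame_def sub_bhyp_def spanned_subgraph_def degree_def h_edges_def Let_def)
  ultimately show ?thesis
    by (simp add: thick_def thick_cone_def) (simp add: sub_bhyp_def)
qed

text \<open>Invariants of the construction. That the whole vertex set is an edge yields thickness of
  \<open>M\<close> itself; the size bound prevents mixed edges from creating new frame
  edges.\<close>

definition full_bhyp :: "'a bhyp \<Rightarrow> bool" where
  "full_bhyp M \<longleftrightarrow> b_hypergraph M \<and> verts M \<in> hedges M \<and> (\<forall>e \<in> hedges M. 2 \<le> card e)"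

section \<open>A single reflection\<close>

locale gluing =
  fixes N :: "'a bhyp" and L X :: "'a set" and \<tau>1 \<tau>2 :: "'a \<Rightarrow> 'b"
  assumes full: "full_bhyp N" and L: "L \<in> hedges N" and X: "X \<subseteq> L"
    and glue: "gluing_maps (verts N) L X \<tau>1 \<tau>2"
begin

abbreviation "M \<equiv> reflect \<tau>1 \<tau>2 L X N"

lemma N: "finite (verts N)" "hedges N \<subseteq> Pow (verts N)" "brel N \<subseteq> Pow (verts N) \<times> Pow (verts N)"
    "sym (brel N)" "verts N \<in> hedges N" "e \<in> hedges N \<Longrightarrow> 2 \<le> card e"
  using full by (auto simp: full_bhyp_def b_hypergraph_def)

lemma L_subset: "L \<subseteq> verts N"
  using L N(2) by blast

lemma inj1: "inj_on \<tau>1 (verts N)" and inj2: "inj_on \<tau>2 L"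
  and tau_eq: "x \<in> verts N \<Longrightarrow> y \<in> L \<Longrightarrow> \<tau>1 x = \<tau>2 y \<longleftrightarrow> x = y \<and> x \<in> X"
  using glue by (auto simp: gluing_maps_def)

lemma hedges_cases:
  assumes "K \<in> hedges M"
  obtains (left) A where "A \<in> hedges N" "K = \<tau>1 ` A"
  | (right) A where "A \<in> hedges N" "A \<subseteq> L" "K = \<tau>2 ` A"
  | (mixed) A C where "A \<in> hedges N" "C \<in> hedges N" "C \<subseteq> L" "X \<subseteq> A \<inter> C" "K = \<tau>1 ` A \<union> \<tau>2 ` C"
  using assms unfolding reflect_def Let_def by auto

lemma brel_cases:
  assumes "(K, K') \<in> brel M"
  obtains (left) A C where "(A, C) \<in> brel N" "K = \<tau>1 ` A" "K' = \<tau>1 ` C"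
  | (right) A C where "(A, C) \<in> brel N" "A \<subseteq> L" "C \<subseteq> L" "K = \<tau>2 ` A" "K' = \<tau>2 ` C"
  | (mixed) A C where "A \<in> hedges N" "C \<in> hedges N" "C \<subseteq> L" "X \<subseteq> A \<inter> C"
      "K = \<tau>1 ` A \<and> K' = \<tau>2 ` C \<or> K = \<tau>2 ` C \<and> K' = \<tau>1 ` A"
  using assms unfolding reflect_def Let_def by auto

lemma verts_M: "verts M = \<tau>1 ` verts N \<union> \<tau>2 ` L"
  by (simp add: reflect_def Let_def)

lemma card_image1: "A \<subseteq> verts N \<Longrightarrow> card (\<tau>1 ` A) = card A"
  using inj1 by (metis card_image inj_on_subset)

lemma card_image2: "A \<subseteq> L \<Longrightarrow> card (\<tau>2 ` A) = card A"
  using inj2 by (metis card_image inj_on_subset)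

text \<open>Points of the two copies coincide only when they come from the same point of
  \<open>X\<close>.\<close>

lemma image_Int:
  assumes "A \<subseteq> verts N" "C \<subseteq> L"
  shows "\<tau>1 ` A \<inter> \<tau>2 ` C = \<tau>1 ` (A \<inter> C \<inter> X)"
proof -
  have "\<tau>1 x \<in> \<tau>2 ` C \<longleftrightarrow> x \<in> C \<inter> X" if "x \<in> A" for x
    using tau_eq[of x] that assms by (auto simp: image_iff)
  then show ?thesis by blast
qed

lemma image_X: "A \<subseteq> X \<Longrightarrow> \<tau>1 ` A = \<tau>2 ` A"
  using tau_eq X L_subset by (intro image_cong refl) blast

lemma full_bhyp_reflect: "full_bhyp M"
proof -
  have fin: "finite (\<tau>1 ` verts N \<union> \<tau>2 ` L)"
    using N(1) L_subset finite_subset by auto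
  have hedges: "K \<subseteq> \<tau>1 ` verts N \<union> \<tau>2 ` L \<and> 2 \<le> card K" if "K \<in> hedges M" for K
    using that
  proof (cases rule: hedges_cases)
    case (left A)
    then show ?thesis
      using N card_image1[of A] by auto
  next
    case (right A)
    then show ?thesis
      using N card_image2[of A] by auto
  next
    case (mixed A C)
    then have sub: "K \<subseteq> \<tau>1 ` verts N \<union> \<tau>2 ` L"
      using N by auto
    have "2 \<le> card (\<tau>1 ` A)"
      using mixed N card_image1[of A] by auto
    also have "\<dots> \<le> card K"
      using mixed sub fin finite_subset by (intro card_mono) auto
    finally show ?thesis
      using sub by simp
  qed
  \<comment> \<open>The new vertex set is the mixed edge built from \<open>verts N\<close> and
    \<open>L\<close>.\<close>
  have "verts M \<in> hedges M"
  proof -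
    have "verts N \<in> hedges N \<and> L \<in> hedges N \<and> L \<subseteq> L \<and> X \<subseteq> verts N \<inter> L"
      using N(5) L X L_subset by auto
    then show ?thesis
      unfolding reflect_def Let_def bhyp.simps by blast
  qed
  moreover have "brel M \<subseteq> Pow (verts M) \<times> Pow (verts M)"
  proof (rule subrelI)
    fix K K' assume "(K, K') \<in> brel M"
    then show "(K, K') \<in> Pow (verts M) \<times> Pow (verts M)"
    proof (cases rule: brel_cases)
      case (left A C)
      then have "A \<subseteq> verts N" "C \<subseteq> verts N"
        using N(3) by auto
      then show ?thesis
        unfolding verts_M left by blast
    next
      case (right A C)
      then show ?thesis
        unfolding verts_M by blast
    next
      case (mixed A C)
      then have "A \<subseteq> verts N"
        using N(2) by auto
      then show ?thesis
        using mixed unfolding verts_M by blast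
    qed
  qed
  moreover have "sym (brel M)"
  proof (rule symI)
    fix K K' assume "(K, K') \<in> brel M"
    then show "(K', K) \<in> brel M"
    proof (cases rule: brel_cases)
      case (left A C)
      then have "(C, A) \<in> brel N"
        using N(4) by (blast dest: symD)
      then show ?thesis
        unfolding reflect_def Let_def bhyp.simps left by blast
    next
      case (right A C)
      then have "(C, A) \<in> brel N \<inter> Pow L \<times> Pow L"
        using N(4) by (blast dest: symD)
      then show ?thesis
        unfolding reflect_def Let_def bhyp.simps right by blast
    next
      case (mixed A C)
      from mixed(5) show ?thesis
        using mixed(1-4) unfolding reflect_def Let_def bhyp.simps by (elim disjE conjE) blast+
    qed
  qed
  ultimately show ?thesis
    using fin hedges verts_M unfolding full_bhyp_def b_hypergraph_def by auto
qed

text \<open>A two-element edge of mixed type contributes nothing new: its two parts have at least two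
  elements each and hence coincide.\<close>

lemma two_edges_reflect:
  "two_edges M Z = (`) \<tau>1 ` {e \<in> two_edges N (verts N). \<tau>1 ` e \<subseteq> Z}
    \<union> (`) \<tau>2 ` {e \<in> two_edges N L. \<tau>2 ` e \<subseteq> Z}" (is "_ = ?R")
proof
  show "two_edges M Z \<subseteq> ?R"
  proof
    fix K assume "K \<in> two_edges M Z"
    then have K: "K \<in> hedges M" "card K = 2" "K \<subseteq> Z"
      by (auto simp: two_edges_def)
    from K(1) show "K \<in> ?R"
    proof (cases rule: hedges_cases)
      case (left A)
      then have "A \<in> two_edges N (verts N)"
        using K N card_image1[of A] by (auto simp: two_edges_def)
      then show ?thesis
        using left K by blast
    next
      case (right A)
      then have "A \<in> two_edges N L"
        using K card_image2[of A] by (auto simp: two_edges_def)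
      then show ?thesis
        using right K by blast
    next
      case (mixed A C)
      have A: "A \<subseteq> verts N" "2 \<le> card (\<tau>1 ` A)"
        using mixed N card_image1[of A] by auto
      have "finite K"
        using K(2) card.infinite by fastforce
      then have "\<tau>1 ` A = K"
        using A K mixed by (intro card_seteq) auto
      then have "A \<in> two_edges N (verts N)"
        using K A mixed card_image1[of A] by (auto simp: two_edges_def)
      then show ?thesis
        using \<open>\<tau>1 ` A = K\<close> K by blast
    qed
  qed
  have "\<tau>1 ` e \<in> two_edges M Z" if "e \<in> two_edges N (verts N)" "\<tau>1 ` e \<subseteq> Z" for e
    using that card_image1[of e] by (auto simp: two_edges_def reflect_def Let_def)
  moreover have "\<tau>2 ` e \<in> two_edges M Z" if "e \<in> two_edges N L" "\<tau>2 ` e \<subseteq> Z" for e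
    using that card_image2[of e] by (auto simp: two_edges_def reflect_def Let_def)
  ultimately show "?R \<subseteq> two_edges M Z"
    by blast
qed

text \<open>A point of the first copy lies in the second part only if it is glued, hence comes from
  \<open>C \<inter> X\<close>, which \<open>A\<close> already contains.\<close>

lemma image1_subset_iff:
  assumes "A \<subseteq> verts N" "C \<subseteq> L" "e \<subseteq> verts N" "C \<inter> X \<subseteq> A"
  shows "\<tau>1 ` e \<subseteq> \<tau>1 ` A \<union> \<tau>2 ` C \<longleftrightarrow> e \<subseteq> A"
proof -
  have "\<tau>1 x \<in> \<tau>1 ` A \<union> \<tau>2 ` C \<longleftrightarrow> x \<in> A" if "x \<in> verts N" for x
  proof -
    have "\<tau>1 x \<in> \<tau>2 ` C \<longleftrightarrow> x \<in> C \<inter> X"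
      using tau_eq[OF that] assms(2) by (auto simp: image_iff)
    then show ?thesis
      using that assms inj_on_image_mem_iff[OF inj1, of x A] by blast
  qed
  then show ?thesis
    using assms by blast
qed

lemma image2_subset_iff:
  assumes "A \<subseteq> verts N" "C \<subseteq> L" "e \<subseteq> L" "A \<inter> X \<subseteq> C"
  shows "\<tau>2 ` e \<subseteq> \<tau>1 ` A \<union> \<tau>2 ` C \<longleftrightarrow> e \<subseteq> C"
proof -
  have "\<tau>2 x \<in> \<tau>1 ` A \<union> \<tau>2 ` C \<longleftrightarrow> x \<in> C" if "x \<in> L" for x
  proof -
    have "\<tau>2 x \<in> \<tau>1 ` A \<longleftrightarrow> x \<in> A \<inter> X"
      using tau_eq[OF _ that] assms(1) by (auto simp: image_iff eq_commute[of "\<tau>2 x"])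
    then show ?thesis
      using that assms inj_on_image_mem_iff[OF inj2, of x C] by blast
  qed
  then show ?thesis
    using assms by blast
qed

lemma two_edges_mixed:
  assumes "A \<subseteq> verts N" "C \<subseteq> L" "X \<subseteq> A \<inter> C"
  shows "two_edges M (\<tau>1 ` A \<union> \<tau>2 ` C) = (`) \<tau>1 ` two_edges N A \<union> (`) \<tau>2 ` two_edges N C"
proof -
  have "{e \<in> two_edges N (verts N). \<tau>1 ` e \<subseteq> \<tau>1 ` A \<union> \<tau>2 ` C} = two_edges N A"
    using assms by (intro two_edges_restrict image1_subset_iff) auto
  moreover have "{e \<in> two_edges N L. \<tau>2 ` e \<subseteq> \<tau>1 ` A \<union> \<tau>2 ` C} = two_edges N C"
    using assms by (intro two_edges_restrict image2_subset_iff) auto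
  ultimately show ?thesis
    unfolding two_edges_reflect by simp
qed

text \<open>The copy of \<open>A\<close> is also the union of the copies of \<open>A\<close> and of
  \<open>A \<inter> X\<close>, so the containment criteria for mixed sets apply. Edges from the
  second copy lie over \<open>A \<inter> X\<close>, where both maps agree, and add nothing.\<close>

lemma two_edges_left:
  assumes "A \<subseteq> verts N"
  shows "two_edges M (\<tau>1 ` A) = (`) \<tau>1 ` two_edges N A"
proof -
  have C: "A \<inter> X \<subseteq> L" "A \<inter> X \<inter> X \<subseteq> A" "A \<inter> X \<subseteq> A \<inter> X"
    using X by auto
  have eq: "\<tau>1 ` A \<union> \<tau>2 ` (A \<inter> X) = \<tau>1 ` A"
    using image_X[of "A \<inter> X"] by blast
  have "{e \<in> two_edges N (verts N). \<tau>1 ` e \<subseteq> \<tau>1 ` A} = two_edges N A"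
    using assms image1_subset_iff[OF assms C(1) _ C(2), unfolded eq]
    by (rule two_edges_restrict)
  moreover have "{e \<in> two_edges N L. \<tau>2 ` e \<subseteq> \<tau>1 ` A} = two_edges N (A \<inter> X)"
    using C(1) image2_subset_iff[OF assms C(1) _ C(3), unfolded eq]
    by (rule two_edges_restrict)
  moreover have "(`) \<tau>2 ` two_edges N (A \<inter> X) \<subseteq> (`) \<tau>1 ` two_edges N A"
  proof (rule image_subsetI)
    fix e assume "e \<in> two_edges N (A \<inter> X)"
    then have "\<tau>2 ` e = \<tau>1 ` e" "e \<in> two_edges N A"
      using image_X[of e] by (auto simp: two_edges_def)
    then show "\<tau>2 ` e \<in> (`) \<tau>1 ` two_edges N A"
      by simp
  qed
  ultimately show ?thesis
    unfolding two_edges_reflect by (simp only: Un_absorb2)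
qed

lemma two_edges_right:
  assumes "C \<subseteq> L"
  shows "two_edges M (\<tau>2 ` C) = (`) \<tau>2 ` two_edges N C"
proof -
  have A: "C \<inter> X \<subseteq> verts N" "C \<inter> X \<inter> X \<subseteq> C" "C \<inter> X \<subseteq> C \<inter> X"
    using X L_subset by auto
  have eq: "\<tau>1 ` (C \<inter> X) \<union> \<tau>2 ` C = \<tau>2 ` C"
    using image_X[of "C \<inter> X"] by blast
  have "{e \<in> two_edges N L. \<tau>2 ` e \<subseteq> \<tau>2 ` C} = two_edges N C"
    using assms image2_subset_iff[OF A(1) assms _ A(2), unfolded eq]
    by (rule two_edges_restrict)
  moreover have "{e \<in> two_edges N (verts N). \<tau>1 ` e \<subseteq> \<tau>2 ` C} = two_edges N (C \<inter> X)"
    using A(1) image1_subset_iff[OF A(1) assms _ A(3), unfolded eq]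
    by (rule two_edges_restrict)
  moreover have "(`) \<tau>1 ` two_edges N (C \<inter> X) \<subseteq> (`) \<tau>2 ` two_edges N C"
  proof (rule image_subsetI)
    fix e assume "e \<in> two_edges N (C \<inter> X)"
    then have "\<tau>1 ` e = \<tau>2 ` e" "e \<in> two_edges N C"
      using image_X[of e] by (auto simp: two_edges_def)
    then show "\<tau>1 ` e \<in> (`) \<tau>2 ` two_edges N C"
      by simp
  qed
  ultimately show ?thesis
    unfolding two_edges_reflect by (simp only: Un_absorb1)
qed

lemma image_h_edges_left:
  assumes A: "A \<subseteq> verts N"
    and thick: "h_edges (two_edges N A) A \<in> thick_cone (brel N \<inter> Pow A \<times> Pow A) A"
  shows "h_edges ((`) \<tau>1 ` two_edges N A) (\<tau>1 ` A)
    \<in> thick_cone (brel M \<inter> Pow (\<tau>1 ` A) \<times> Pow (\<tau>1 ` A)) (\<tau>1 ` A)"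
proof (rule image_h_edges_thick[OF _ _ thick])
  show "inj_on \<tau>1 A"
    using inj1 A by (rule inj_on_subset)
qed (auto simp: two_edges_def reflect_def Let_def)

lemma image_h_edges_right:
  assumes A: "A \<subseteq> L"
    and thick: "h_edges (two_edges N A) A \<in> thick_cone (brel N \<inter> Pow A \<times> Pow A) A"
  shows "h_edges ((`) \<tau>2 ` two_edges N A) (\<tau>2 ` A)
    \<in> thick_cone (brel M \<inter> Pow (\<tau>2 ` A) \<times> Pow (\<tau>2 ` A)) (\<tau>2 ` A)"
proof (rule image_h_edges_thick[OF _ _ thick])
  show "inj_on \<tau>2 A"
    using inj2 A by (rule inj_on_subset)
  fix P Q assume "(P, Q) \<in> brel N" "P \<subseteq> A" "Q \<subseteq> A"
  \<comment> \<open>Only pairs inside \<open>L\<close> are copied by \<open>\<tau>2\<close>, and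
    here both sets lie in \<open>A \<subseteq> L\<close>.\<close>
  then have "(P, Q) \<in> brel N \<inter> Pow L \<times> Pow L"
    using A by blast
  then show "(\<tau>2 ` P, \<tau>2 ` Q) \<in> brel M"
    unfolding reflect_def Let_def bhyp.simps by blast
qed (auto simp: two_edges_def)

text \<open>Edges of one copy inherit thickness by relabelling. A mixed edge is decomposed by
  \<open>h_edges_Un\<close>, and each of the four summands lies in the cone; the forest condition
  handles the overlap \<open>X\<close>.\<close>

lemma h_edges_reflect_thick:
  assumes thick: "\<And>K. K \<in> hedges N \<Longrightarrow>
      h_edges (two_edges N K) K \<in> thick_cone (brel N \<inter> Pow K \<times> Pow K) K"
    and forest: "forest (spanned_subgraph (frame N) X)"
    and K: "K \<in> hedges M"
  shows "h_edges (two_edges M K) K \<in> thick_cone (brel M \<inter> Pow K \<times> Pow K) K"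
  using K
proof (cases rule: hedges_cases)
  case (left A)
  then have "A \<subseteq> verts N"
    using N by blast
  then show ?thesis
    using image_h_edges_left two_edges_left thick left by simp
next
  case (right A)
  then show ?thesis
    using image_h_edges_right two_edges_right thick by simp
next
  case (mixed A C)
  let ?T = "thick_cone (brel M \<inter> Pow K \<times> Pow K) K"
  let ?F = "(`) \<tau>1 ` two_edges N A" and ?G = "(`) \<tau>2 ` two_edges N C"
  have A: "A \<subseteq> verts N" and X: "X \<subseteq> A" "X \<subseteq> C" "X \<subseteq> verts N" and C: "C \<subseteq> L"
    using mixed(1-4) N(2) by blast+
  have FG: "?F \<subseteq> Pow (\<tau>1 ` A)" "?G \<subseteq> Pow (\<tau>2 ` C)"
    by (auto simp: two_edges_def)
  \<comment> \<open>An edge present in both copies consists of glued points, so it comes from an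
    edge inside \<open>X\<close>.\<close>
  have "?F \<inter> ?G = (`) \<tau>1 ` two_edges N X"
  proof
    show "?F \<inter> ?G \<subseteq> (`) \<tau>1 ` two_edges N X"
    proof
      fix f assume "f \<in> ?F \<inter> ?G"
      then obtain e e' where e: "e \<in> two_edges N A" "f = \<tau>1 ` e" and e': "e' \<in> two_edges N C" "f = \<tau>2 ` e'"
        by blast
      have "e \<subseteq> X"
      proof
        fix x assume x: "x \<in> e"
        then obtain y where "y \<in> e'" "\<tau>1 x = \<tau>2 y"
          using e e' by blast
        moreover have "x \<in> verts N" "y \<in> L" if "y \<in> e'" for y
          using that x e e' A C by (auto simp: two_edges_def)
        ultimately show "x \<in> X"
          using tau_eq by blast
      qed
      then show "f \<in> (`) \<tau>1 ` two_edges N X"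
        using e by (auto simp: two_edges_def)
    qed
    have "\<tau>1 ` e \<in> ?F \<inter> ?G" if "e \<in> two_edges N X" for e
    proof -
      have "e \<in> two_edges N A" "e \<in> two_edges N C" "\<tau>1 ` e = \<tau>2 ` e"
        using that X image_X[of e] by (auto simp: two_edges_def)
      then show ?thesis by blast
    qed
    then show "(`) \<tau>1 ` two_edges N X \<subseteq> ?F \<inter> ?G"
      by blast
  qed
  moreover have "\<tau>1 ` A \<inter> \<tau>2 ` C = \<tau>1 ` X"
  proof -
    have "A \<inter> C \<inter> X = X"
      using X by auto
    then show ?thesis
      using image_Int[OF A C] by simp
  qed
  moreover have "finite (\<tau>1 ` A)" "finite (\<tau>2 ` C)"
    using A C N(1) L_subset by (auto intro!: finite_imageI elim: finite_subset)
  ultimately have "h_edges (two_edges M K) K = - t_vec (\<tau>1 ` A) (\<tau>2 ` C)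
      + h_edges ?F (\<tau>1 ` A) + h_edges ?G (\<tau>2 ` C) - h_edges ((`) \<tau>1 ` two_edges N X) (\<tau>1 ` X)"
    using h_edges_Un[OF _ _ FG] two_edges_mixed[of A C] A C X mixed by simp
  \<comment> \<open>The subtraction becomes addition of a negative, since the cone is closed under
    sums only.\<close>
  then have eq: "h_edges (two_edges M K) K = - t_vec (\<tau>1 ` A) (\<tau>2 ` C)
      + h_edges ?F (\<tau>1 ` A) + h_edges ?G (\<tau>2 ` C) + - h_edges ((`) \<tau>1 ` two_edges N X) (\<tau>1 ` X)"
    by simp
  have "(\<tau>1 ` A, \<tau>2 ` C) \<in> brel M \<inter> Pow K \<times> Pow K"
    using mixed by (auto simp: reflect_def Let_def)
  then have "t_vec (\<tau>1 ` A) (\<tau>2 ` C) \<in> W_space (brel M \<inter> Pow K \<times> Pow K)"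
    unfolding W_space_def by (intro span_base) blast
  \<comment> \<open>The negative sign is harmless because the relation contributes a linear
    span.\<close>
  then have "- t_vec (\<tau>1 ` A) (\<tau>2 ` C) \<in> W_space (brel M \<inter> Pow K \<times> Pow K)"
    unfolding W_space_def by (rule span_neg)
  then have 1: "- t_vec (\<tau>1 ` A) (\<tau>2 ` C) \<in> ?T"
    using W_space_subset_thick_cone by blast
  have "h_edges ?F (\<tau>1 ` A) \<in> thick_cone (brel M \<inter> Pow (\<tau>1 ` A) \<times> Pow (\<tau>1 ` A)) (\<tau>1 ` A)"
    using image_h_edges_left[OF A thick] mixed by simp
  also have "\<dots> \<subseteq> ?T"
    using mixed by (intro thick_cone_mono) auto
  finally have 2: "h_edges ?F (\<tau>1 ` A) \<in> ?T" .
  have "h_edges ?G (\<tau>2 ` C) \<in> thick_cone (brel M \<inter> Pow (\<tau>2 ` C) \<times> Pow (\<tau>2 ` C)) (\<tau>2 ` C)"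
    using image_h_edges_right[OF C thick] mixed by simp
  also have "\<dots> \<subseteq> ?T"
    using mixed by (intro thick_cone_mono) auto
  finally have 3: "h_edges ?G (\<tau>2 ` C) \<in> ?T" .
  have injX: "inj_on \<tau>1 X"
    using inj1 X(3) by (rule inj_on_subset)
  have "- h_edges ((`) \<tau>1 ` two_edges N X) (\<tau>1 ` X) \<in> ?T"
  proof -
    let ?E = "(`) \<tau>1 ` two_edges N X"
    have "{e \<in> snd (frame N). e \<subseteq> X} = two_edges N X"
      by (auto simp: frame_def two_edges_def)
    then have "forest (X, two_edges N X)"
      using forest by (simp add: spanned_subgraph_def)
    moreover have "finite X"
      using X(3) N(1) by (rule finite_subset)
    ultimately have "- h_edges (two_edges N X) X \<in> Q_cone X"
      by (intro uminus_h_edges_forest) (auto simp: two_edges_def)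
    \<comment> \<open>The empty relation suffices, as the vector already lies in
      \<open>Q_cone X\<close>; this puts it in the form required for transport.\<close>
    then have "- h_edges (two_edges N X) X \<in> thick_cone {} X"
      using Q_cone_subset_thick_cone by blast
    then have "push \<tau>1 X (- h_edges (two_edges N X) X) \<in> thick_cone {} (\<tau>1 ` X)"
      using push_thick_cone[OF injX, of "{}"] by simp
    also have "push \<tau>1 X (- h_edges (two_edges N X) X) = - h_edges ?E (\<tau>1 ` X)"
      unfolding linear_neg[OF linear_push]
      using injX by (subst push_h_edges) (auto simp: two_edges_def)
    also have "thick_cone {} (\<tau>1 ` X) \<subseteq> ?T"
      using mixed by (intro thick_cone_mono) auto
    finally show ?thesis .
  qed
  with 1 2 3 show ?thesis
    unfolding eq by (intro thick_cone_add)
qed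

end

section \<open>Induction over the class\<close>

text \<open>The structural invariant is proved together with thickness because the reflection step
  relies on it for \<open>N\<close>.\<close>

lemma class_C_thick_edges:
  assumes "M \<in> class_C"
  shows "full_bhyp M \<and>
    (\<forall>K \<in> hedges M. h_edges (two_edges M K) K \<in> thick_cone (brel M \<inter> Pow K \<times> Pow K) K)"
  using assms
proof induction
  case (trivial a b)
  let ?M = "\<lparr>verts = {a, b}, hedges = {{a, b}}, brel = {}\<rparr>"
  have "two_edges ?M {a, b} = {{a, b}}"
    using trivial by (auto simp: two_edges_def)
  moreover have "{e \<in> {{a, b}}. v \<in> e} = {{a, b}}" if "v \<in> {a, b}" for v
    using that by auto
  \<comment> \<open>Both vertices have degree 1 and the edge is the whole vertex set, so everything
    cancels.\<close>
  then have "h_edges {{a, b}} {a, b} = 0 *\<^sub>R ind {}"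
    by (simp add: h_edges_def)
  then have "h_edges {{a, b}} {a, b} \<in> thick_cone B {a, b}" for B
    using ind_empty_in_Q_cone Q_cone_subset_thick_cone by (metis subsetD)
  ultimately show ?case
    using trivial by (simp add: full_bhyp_def b_hypergraph_def sym_def)
next
  case (reflect N L X \<tau>1 \<tau>2)
  then interpret gluing N L X \<tau>1 \<tau>2
    by unfold_locales auto
  show ?case
    using full_bhyp_reflect h_edges_reflect_thick reflect by blast
qed

theorem theorem6p9:
  fixes M :: "'a bhyp"
  assumes "M \<in> class_C"
  shows "(\<forall>K \<in> hedges M. thick (sub_bhyp M K)) \<and>
         reflection_complex M \<and> thick M \<and> thick_graph (frame M)"
proof -
  have M: "full_bhyp M" "\<And>K. K \<in> hedges M \<Longrightarrow>
      h_edges (two_edges M K) K \<in> thick_cone (brel M \<inter> Pow K \<times> Pow K) K"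
    using class_C_thick_edges[OF assms] by auto
  then have thick: "thick (sub_bhyp M K)" if "K \<in> hedges M" for K
    using that by (subst thick_sub_bhyp_iff) (auto simp: full_bhyp_def b_hypergraph_def)
  \<comment> \<open>As \<open>verts M\<close> is itself an edge, thickness of \<open>M\<close> is
    one instance of the claim about edges; \<open>M\<close> then witnesses that its frame is
    thick.\<close>
  have "sub_bhyp M (verts M) = M"
    using M(1) by (intro bhyp.equality) (auto simp: full_bhyp_def b_hypergraph_def sub_bhyp_def)
  then have "thick M"
    using thick[of "verts M"] M(1) by (simp add: full_bhyp_def)
  moreover have "reflection_complex M"
    using assms by (rule class_C_reflection_complex)
  ultimately show ?thesis
    using thick by (auto simp: thick_graph_def)
qed

end
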